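(* A $1$-dimensional bounded one-parameter family $F_t$ (i.e. a bounded family on $\mathbb{R}$) is uniform; equivalently, the limit $A^*:=\lim_{t\to t_0}A_t$ exists, where $A_t$ is the attractor of $F_t$ for $t\in[0,t_0)$.
   Context: A function $f:\mathbb{R}^d\to\mathbb{R}^d$ is affine if $f(x)=Lx+a$, where $L$ is a non-singular $d\times d$ real matrix (the linear part of $f$) and $a\in\mathbb{R}^d$. A one-parameter affine family is given by $N\ge 2$ affine functions $F=\{f_1,\dots,f_N\}$ on $\mathbb{R}^d$ and vectors $q_1,\dots,q_N\in\mathbb{R}^d$; for each real $t\ge 0$ it is $F_t=\{f_{(i,t)} : 1\le i\le N\}$ with $f_{(i,t)}(x)=t f_i(x)+q_i$. It is a similarity family if each function is a similarity transformation. The Hutchinson operator of $F_t$ on non-empty compact sets is $F_t(K)=\bigcup_{f\in F_t} f(K)$. A non-empty compact set $A_t$ is the attractor of $F_t$ if $A_t=\lim_{k\to\infty}F_t^k(K)$ in the Hausdorff metric for every non-empty compact $K$. If $L_1,\dots,L_N$ are the linear parts of $f_1,\dots,f_N$, the joint spectral radius of $F$ is $\rho(F)=\limsup_{k\to\infty}\big(\max\|L_{i_1}\cdots L_{i_k}\|\big)^{1/k}$, the maximum being over all words of length $k$ in $\{1,\dots,N\}$. Set $t_0=1/\rho(F)$; the attractor $A_t$ exists exactly for $t\in[0,t_0)$. Functions $f,g$ on $\mathbb{R}^d$ are conjugate by a function $h$ if $g=h^{-1}fh$. The family $F_t$ is semi-linear if, for all $i$ and all $t\in[0,t_0)$, $f_{(i,t)}$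 is conjugate to a linear function by a function $h_i$ independent of $t$. A one-parameter similarity family $F_t$ is bounded if it is semi-linear and there is a unique function $\widehat f_t(x)=t\widehat f(x)+q_*\in F_t$ such that $\widehat f$ has maximum scaling ratio (among $f_1,\dots,f_N$). A one-parameter affine family $F_t$ is uniform if the function $t\mapsto A_t$ is uniformly continuous on the interval $(0,t_0)$ with respect to the Hausdorff metric. Limits of sets are with respect to the Hausdorff metric, and $t\to t_0$ is through values $t<t_0$. *)

theory Defs
  imports "HOL-Analysis.Analysis"
begin

definition nonsingular_affine :: "('a::euclidean_space \<Rightarrow> 'a) \<Rightarrow> bool" where
  "nonsingular_affine f \<longleftrightarrow> (\<exists>L a. linear L \<and> bij L \<and> f = (\<lambda>x. L x + a))"

definition linear_part :: "('a::euclidean_space \<Rightarrow> 'a) \<Rightarrow> 'a \<Rightarrow> 'a" where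
  "linear_part f = (\<lambda>x. f x - f 0)"

text \<open>A family is given by a number \<open>N\<close>, functions \<open>f 1, \<dots>, f N\<close> and vectors
  \<open>q 1, \<dots>, q N\<close>; values of \<open>f\<close> and \<open>q\<close> at other indices are irrelevant.\<close>

definition affine_family :: "nat \<Rightarrow> (nat \<Rightarrow> 'a::euclidean_space \<Rightarrow> 'a) \<Rightarrow> (nat \<Rightarrow> 'a) \<Rightarrow> bool" where
  "affine_family N f q \<longleftrightarrow> 2 \<le> N \<and> (\<forall>i\<in>{1..N}. nonsingular_affine (f i))"

definition fam_fun :: "(nat \<Rightarrow> 'a::euclidean_space \<Rightarrow> 'a) \<Rightarrow> (nat \<Rightarrow> 'a) \<Rightarrow> nat \<Rightarrow> real \<Rightarrow> 'a \<Rightarrow> 'a" where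
  "fam_fun f q i t = (\<lambda>x. t *\<^sub>R f i x + q i)"

definition fam :: "nat \<Rightarrow> (nat \<Rightarrow> 'a::euclidean_space \<Rightarrow> 'a) \<Rightarrow> (nat \<Rightarrow> 'a) \<Rightarrow> real \<Rightarrow> ('a \<Rightarrow> 'a) set" where
  "fam N f q t = (\<lambda>i. fam_fun f q i t) ` {1..N}"

text \<open>This is the Hausdorff metric only on non-empty compact sets (for unbounded or empty
  arguments the suprema are unspecified), and it is applied only to such sets.\<close>

definition hausdorff_dist :: "'a::metric_space set \<Rightarrow> 'a set \<Rightarrow> real" where
  "hausdorff_dist A B = max (SUP a\<in>A. infdist a B) (SUP b\<in>B. infdist b A)"

definition hutchinson :: "('a \<Rightarrow> 'a) set \<Rightarrow> 'a set \<Rightarrow> 'a set" where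
  "hutchinson G K = (\<Union>g\<in>G. g ` K)"

definition is_attractor :: "('a::metric_space \<Rightarrow> 'a) set \<Rightarrow> 'a set \<Rightarrow> bool" where
  "is_attractor G A \<longleftrightarrow> compact A \<and> A \<noteq> {} \<and>
     (\<forall>K. compact K \<and> K \<noteq> {} \<longrightarrow>
        (\<lambda>k. hausdorff_dist ((hutchinson G ^^ k) K) A) \<longlonglongrightarrow> 0)"

definition attractor :: "('a::metric_space \<Rightarrow> 'a) set \<Rightarrow> 'a set" where
  "attractor G = (THE A. is_attractor G A)"

text \<open>The word \<open>[i\<^sub>1, \<dots>, i\<^sub>k]\<close> yields the composite \<open>L\<^sub>1 \<circ> \<dots> \<circ> L\<^sub>k\<close> of the
  corresponding linear parts.\<close>

definition word_map :: "(nat \<Rightarrow> 'a::euclidean_space \<Rightarrow> 'a) \<Rightarrow> nat list \<Rightarrow> 'a \<Rightarrow> 'a" where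
  "word_map f w = foldr (\<lambda>i g. linear_part (f i) \<circ> g) w id"

definition joint_spectral_radius :: "nat \<Rightarrow> (nat \<Rightarrow> 'a::euclidean_space \<Rightarrow> 'a) \<Rightarrow> real" where
  "joint_spectral_radius N f = real_of_ereal (limsup (\<lambda>k. ereal
     (root k (Max {onorm (word_map f w) |w. length w = k \<and> set w \<subseteq> {1..N}}))))"

definition t_crit :: "nat \<Rightarrow> (nat \<Rightarrow> 'a::euclidean_space \<Rightarrow> 'a) \<Rightarrow> real" where
  "t_crit N f = 1 / joint_spectral_radius N f"

definition has_scaling_ratio :: "('a::metric_space \<Rightarrow> 'a) \<Rightarrow> real \<Rightarrow> bool" where
  "has_scaling_ratio f r \<longleftrightarrow> r > 0 \<and> (\<forall>x y. dist (f x) (f y) = r * dist x y)"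

definition similarity :: "('a::metric_space \<Rightarrow> 'a) \<Rightarrow> bool" where
  "similarity f \<longleftrightarrow> (\<exists>r. has_scaling_ratio f r)"

definition scaling_ratio :: "('a::metric_space \<Rightarrow> 'a) \<Rightarrow> real" where
  "scaling_ratio f = (THE r. has_scaling_ratio f r)"

definition similarity_family :: "nat \<Rightarrow> (nat \<Rightarrow> 'a::euclidean_space \<Rightarrow> 'a) \<Rightarrow> (nat \<Rightarrow> 'a) \<Rightarrow> bool" where
  "similarity_family N f q \<longleftrightarrow> affine_family N f q \<and> (\<forall>i\<in>{1..N}. similarity (f i))"

definition conjugate_by :: "('a \<Rightarrow> 'a) \<Rightarrow> ('a \<Rightarrow> 'a) \<Rightarrow> ('a \<Rightarrow> 'a) \<Rightarrow> bool" where
  "conjugate_by h f g \<longleftrightarrow> bij h \<and> g = inv h \<circ> f \<circ> h"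

text \<open>The linear function need not be invertible: at \<open>t = 0\<close> it is the zero map.\<close>

definition semi_linear :: "nat \<Rightarrow> (nat \<Rightarrow> 'a::euclidean_space \<Rightarrow> 'a) \<Rightarrow> (nat \<Rightarrow> 'a) \<Rightarrow> bool" where
  "semi_linear N f q \<longleftrightarrow> affine_family N f q \<and>
     (\<forall>i\<in>{1..N}. \<exists>h. \<forall>t\<in>{0..<t_crit N f}. \<exists>g. linear g \<and> conjugate_by h (fam_fun f q i t) g)"

text \<open>Uniqueness is that of the function \<open>(t, x) \<mapsto> t f\<^sub>i(x) + q\<^sub>i\<close>, not of the index \<open>i\<close>;
  a function may be listed more than once.\<close>

definition bounded_family :: "nat \<Rightarrow> (nat \<Rightarrow> 'a::euclidean_space \<Rightarrow> 'a) \<Rightarrow> (nat \<Rightarrow> 'a) \<Rightarrow> bool" where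
  "bounded_family N f q \<longleftrightarrow> similarity_family N f q \<and> semi_linear N f q \<and>
     (\<exists>!g. \<exists>i\<in>{1..N}. g = fam_fun f q i \<and>
        scaling_ratio (f i) = Max ((\<lambda>j. scaling_ratio (f j)) ` {1..N}))"

definition uniform_family :: "nat \<Rightarrow> (nat \<Rightarrow> 'a::euclidean_space \<Rightarrow> 'a) \<Rightarrow> (nat \<Rightarrow> 'a) \<Rightarrow> bool" where
  "uniform_family N f q \<longleftrightarrow> affine_family N f q \<and>
     (\<forall>e>0. \<exists>d>0. \<forall>s\<in>{0<..<t_crit N f}. \<forall>t\<in>{0<..<t_crit N f}. \<bar>s - t\<bar> < d \<longrightarrow>
        hausdorff_dist (attractor (fam N f q s)) (attractor (fam N f q t)) < e)"

end

theory Submission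
  imports Defs
begin

text \<open>
  A map that is conjugate to a linear map by the same \<open>h\<close> for every parameter fixes \<open>h 0\<close> for
  every parameter. In a semi-linear family \<open>t f\<^sub>i + q\<^sub>i\<close> that common fixed point is \<open>q\<^sub>i\<close>
  (put \<open>t = 0\<close>), so on the line the family is \<open>g\<^sub>i\<^sub>,\<^sub>t x = q\<^sub>i + t m\<^sub>i (x - q\<^sub>i)\<close>, and it contracts
  precisely up to \<open>t\<^sub>0 = 1 / max \<bar>m\<^sub>i\<bar>\<close>. In a bounded family one map, with fixed
  point \<open>q\<^sub>*\<close>, has the largest ratio, and all maps different from it have ratio at most a
  factor \<open>c < 1\<close> of it. As \<open>t\<close> tends to \<open>t\<^sub>0\<close> the dominant map tends to an isometry \<open>u\<close>, either
  the identity or the reflection at \<open>q\<^sub>*\<close>, while the others remain contractions with factor \<open>c\<close>.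

  Below \<open>t\<^sub>0\<close>, the attractor \<open>A\<^sub>t\<close> is the union of \<open>S = {q\<^sub>*} \<union> \<Union> g\<^sub>i\<^sub>,\<^sub>t(A\<^sub>t)\<close>, over the dominated
  maps, and its own image under the dominant map. Near \<open>t\<^sub>0\<close> the dominant map moves a point
  of \<open>S\<close> towards \<open>q\<^sub>*\<close> in tiny steps (alternating sides if it reverses orientation). Since a
  line is one-dimensional, these orbits become dense in the whole interval
  \<open>sweep S = hull (S \<union> u S)\<close>. So \<open>A\<^sub>t\<close> is almost a fixed point of the operator that sends \<open>K\<close> to
  \<open>sweep ({q\<^sub>*} \<union> \<Union> g\<^sub>i\<^sub>,\<^sub>t\<^sub>0(K))\<close>. This operator is a contraction with factor \<open>c\<close> for the
  Hausdorff distance, hence it has a fixed point \<open>L\<close>, and an almost fixed point is close to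
  \<open>L\<close>. This gives \<open>A\<^sub>t \<rightarrow> L\<close> with an explicit rate (\<open>attractor_limit_bound\<close>). Away from \<open>t\<^sub>0\<close>
  the attractor is Lipschitz in \<open>t\<close> (\<open>attractor_lipschitz\<close>), and the two facts together give
  uniform continuity.

  Both the attractors and \<open>L\<close> come from \<open>set_contraction_attractor\<close>: a monotone contraction of
  compact sets that maps some \<open>K0\<close> into itself has the intersection of the iterates of \<open>K0\<close> as
  its attractor.
\<close>

section \<open>The Hausdorff distance of compact sets\<close>

text \<open>Estimates are carried out one side at a time: \<open>A\<close> lies in the closed \<open>e\<close>-neighbourhood of
  \<open>B\<close>. Unlike the suprema of \<open>hausdorff_dist\<close>, this relation makes sense for all sets and
  passes easily through unions, images and hulls.\<close>

definition near :: "real \<Rightarrow> 'a::metric_space set \<Rightarrow> 'a set \<Rightarrow> bool" where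
  "near e A B \<longleftrightarrow> (\<forall>a\<in>A. \<exists>b\<in>B. dist a b \<le> e)"

lemma nearI: "(\<And>a. a \<in> A \<Longrightarrow> \<exists>b\<in>B. dist a b \<le> e) \<Longrightarrow> near e A B"
  by (simp add: near_def)

lemma nearE:
  assumes "near e A B" "a \<in> A"
  obtains b where "b \<in> B" "dist a b \<le> e"
  using assms by (auto simp: near_def)

lemma near_subset: "A \<subseteq> B \<Longrightarrow> 0 \<le> e \<Longrightarrow> near e A B"
  by (force simp: near_def)

lemma near_trans:
  assumes "near d A B" "near e B C"
  shows "near (d + e) A C"
proof (rule nearI)
  fix a assume "a \<in> A"
  then obtain b where b: "b \<in> B" "dist a b \<le> d" using assms(1) by (elim nearE)
  then obtain c where "c \<in> C" "dist b c \<le> e" using assms(2) by (elim nearE)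
  with b show "\<exists>c\<in>C. dist a c \<le> d + e"
    using dist_triangle[of a c b] by force
qed

lemma SUP_infdist_le_iff:
  assumes "compact A" "A \<noteq> {}" "compact B" "B \<noteq> {}"
  shows "(SUP a\<in>A. infdist a B) \<le> e \<longleftrightarrow> near e A B"
proof -
  have "bounded ((\<lambda>a. infdist a B) ` A)"
    by (intro compact_imp_bounded compact_continuous_image continuous_intros assms)
  then have bdd: "bdd_above ((\<lambda>a. infdist a B) ` A)"
    by (rule bounded_imp_bdd_above)
  have "(SUP a\<in>A. infdist a B) \<le> e \<longleftrightarrow> (\<forall>a\<in>A. infdist a B \<le> e)"
    using assms(2) bdd by (auto simp: cSUP_le_iff)
  also have "\<dots> \<longleftrightarrow> near e A B"
  proof
    assume le: "\<forall>a\<in>A. infdist a B \<le> e"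
    show "near e A B"
    proof (rule nearI)
      fix a assume "a \<in> A"
      moreover obtain b where "b \<in> B" "\<forall>y\<in>B. dist a b \<le> dist a y"
        using continuous_attains_inf[OF assms(3,4), of "dist a"]
        by (auto simp: continuous_on_dist continuous_on_const continuous_on_id)
      ultimately show "\<exists>b\<in>B. dist a b \<le> e"
        using le assms(4) by (metis cINF_greatest infdist_notempty order_trans)
    qed
  qed (auto simp: near_def intro: infdist_le2)
  finally show ?thesis .
qed

lemma hausdorff_dist_le_iff:
  assumes "compact A" "A \<noteq> {}" "compact B" "B \<noteq> {}"
  shows "hausdorff_dist A B \<le> e \<longleftrightarrow> near e A B \<and> near e B A"
  using assms by (simp add: hausdorff_dist_def SUP_infdist_le_iff)

lemma near_hausdorff_dist:
  assumes "compact A" "A \<noteq> {}" "compact B" "B \<noteq> {}"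
  shows "near (hausdorff_dist A B) A B" "near (hausdorff_dist A B) B A"
  using hausdorff_dist_le_iff[OF assms] by blast+

lemma hausdorff_dist_commute: "hausdorff_dist A B = hausdorff_dist B A"
  by (simp add: hausdorff_dist_def max.commute)

lemma hausdorff_dist_nonneg:
  assumes "compact A" "A \<noteq> {}" "compact B" "B \<noteq> {}"
  shows "0 \<le> hausdorff_dist A B"
proof -
  obtain a where "a \<in> A" using assms by blast
  then obtain b where "dist a b \<le> hausdorff_dist A B"
    using near_hausdorff_dist(1)[OF assms] by (elim nearE)
  then show ?thesis using zero_le_dist order_trans by blast
qed

lemma hausdorff_dist_triangle:
  assumes "compact A" "A \<noteq> {}" "compact B" "B \<noteq> {}" "compact C" "C \<noteq> {}"
  shows "hausdorff_dist A C \<le> hausdorff_dist A B + hausdorff_dist B C"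
  using assms near_hausdorff_dist[of A B] near_hausdorff_dist[of B C]
  by (auto simp: hausdorff_dist_le_iff add.commute intro: near_trans
      dest: near_trans[of "hausdorff_dist B C" C B "hausdorff_dist A B" A])

lemma near_zero_subset: "near 0 A B \<Longrightarrow> A \<subseteq> B"
  by (auto simp: near_def)

lemma hausdorff_dist_eq_0_imp_eq:
  assumes "compact A" "A \<noteq> {}" "compact B" "B \<noteq> {}" "hausdorff_dist A B \<le> 0"
  shows "A = B"
  using assms hausdorff_dist_le_iff[of A B 0] near_zero_subset by blast

text \<open>What makes the attractor unique.\<close>

lemma hausdorff_dist_LIMSEQ_unique:
  assumes "\<And>n. compact (X n) \<and> X n \<noteq> {}"
    and "compact A" "A \<noteq> {}" "compact B" "B \<noteq> {}"
    and "(\<lambda>n. hausdorff_dist (X n) A) \<longlonglongrightarrow> 0" "(\<lambda>n. hausdorff_dist (X n) B) \<longlonglongrightarrow> 0"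
  shows "A = B"
proof -
  have "(\<lambda>n. hausdorff_dist (X n) A + hausdorff_dist (X n) B) \<longlonglongrightarrow> 0 + 0"
    by (intro tendsto_intros assms)
  moreover have "hausdorff_dist A B \<le> hausdorff_dist (X n) A + hausdorff_dist (X n) B" for n
    using hausdorff_dist_triangle[of A "X n" B] assms by (simp add: hausdorff_dist_commute[of A])
  ultimately have "hausdorff_dist A B \<le> 0"
    by (intro LIMSEQ_le_const[of _ 0]) auto
  then show ?thesis using assms by (intro hausdorff_dist_eq_0_imp_eq)
qed

text \<open>The parts of the sets outside an open neighbourhood of the intersection are decreasing
  compact sets without a common point, so one of them is empty.\<close>

lemma hausdorff_dist_decseq_LIMSEQ:
  fixes X :: "nat \<Rightarrow> 'a::heine_borel set"
  assumes cpt: "\<And>n. compact (X n)" and ne: "\<And>n. X n \<noteq> {}" and dec: "decseq X"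
  shows "compact (\<Inter>n. X n)" "(\<Inter>n. X n) \<noteq> {}"
    "(\<lambda>n. hausdorff_dist (X n) (\<Inter>n. X n)) \<longlonglongrightarrow> 0"
proof -
  let ?A = "\<Inter>n. X n"
  have mono: "X n \<subseteq> X m" if "m \<le> n" for m n
    using dec that by (simp add: decseq_def)
  show A: "compact ?A"
    using cpt by (intro compact_Inter) auto
  show ne': "?A \<noteq> {}"
    using compact_nest[of X] cpt ne mono by blast
  show "(\<lambda>n. hausdorff_dist (X n) ?A) \<longlonglongrightarrow> 0"
  proof (rule LIMSEQ_I)
    fix e :: real assume e: "0 < e"
    let ?U = "\<Union>a\<in>?A. ball a (e/2)"
    have "\<exists>n. X n - ?U = {}"
    proof (rule ccontr)
      assume *: "\<nexists>n. X n - ?U = {}"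
      have "(\<Inter>n. X n - ?U) \<noteq> {}"
        using * mono by (intro compact_nest compact_diff cpt open_UN ballI open_ball) blast+
      moreover have "?A \<subseteq> ?U" using e by auto
      ultimately show False by auto
    qed
    then obtain n0 where n0: "X n0 \<subseteq> ?U" by blast
    have "norm (hausdorff_dist (X n) ?A - 0) < e" if "n0 \<le> n" for n
    proof -
      have "near (e/2) (X n) ?A"
      proof (rule nearI)
        fix x assume "x \<in> X n"
        then have "x \<in> ?U" using n0 mono that by blast
        then obtain a where "a \<in> ?A" "x \<in> ball a (e/2)" by blast
        then show "\<exists>a\<in>?A. dist x a \<le> e/2"
          by (auto simp: dist_commute intro!: bexI[of _ a])
      qed
      moreover have "near (e/2) ?A (X n)"
        using e by (intro near_subset) auto
      ultimately have "hausdorff_dist (X n) ?A \<le> e/2"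
        using hausdorff_dist_le_iff[OF cpt ne A ne'] by blast
      moreover have "0 \<le> hausdorff_dist (X n) ?A"
        using cpt ne A ne' by (intro hausdorff_dist_nonneg)
      ultimately show ?thesis using e by simp
    qed
    then show "\<exists>n0. \<forall>n\<ge>n0. norm (hausdorff_dist (X n) ?A - 0) < e" by blast
  qed
qed

section \<open>Attractors of monotone contractions of sets\<close>

text \<open>Iterating \<open>\<Psi>\<close> on \<open>K0\<close> gives a decreasing sequence of compact sets. Monotonicity thus replaces
  the completeness of the space of compact sets in Banach's fixed point theorem, and it also
  places the attractor inside \<open>K0\<close>.\<close>

lemma set_contraction_attractor:
  fixes \<Psi> :: "'a::heine_borel set \<Rightarrow> 'a set"
  assumes c: "0 \<le> c" "c < 1"
    and cpt: "\<And>K. compact K \<Longrightarrow> K \<noteq> {} \<Longrightarrow> compact (\<Psi> K) \<and> \<Psi> K \<noteq> {}"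
    and mono: "\<And>K K'. K \<subseteq> K' \<Longrightarrow> \<Psi> K \<subseteq> \<Psi> K'"
    and contr: "\<And>K K'. compact K \<Longrightarrow> K \<noteq> {} \<Longrightarrow> compact K' \<Longrightarrow> K' \<noteq> {} \<Longrightarrow>
      hausdorff_dist (\<Psi> K) (\<Psi> K') \<le> c * hausdorff_dist K K'"
    and K0: "compact K0" "K0 \<noteq> {}" "\<Psi> K0 \<subseteq> K0"
  obtains A where "compact A" "A \<noteq> {}" "A \<subseteq> K0" "\<Psi> A = A"
    "\<And>K. compact K \<Longrightarrow> K \<noteq> {} \<Longrightarrow> (\<lambda>n. hausdorff_dist ((\<Psi> ^^ n) K) A) \<longlonglongrightarrow> 0"
proof -
  define X where "X n = (\<Psi> ^^ n) K0" for n
  define A where "A = (\<Inter>n. X n)"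
  have iter: "compact ((\<Psi> ^^ n) K) \<and> (\<Psi> ^^ n) K \<noteq> {}" if "compact K" "K \<noteq> {}" for n K
    using that by (induction n) (auto simp: cpt)
  have X: "compact (X n)" "X n \<noteq> {}" for n
    using iter[OF K0(1,2)] by (auto simp: X_def)
  have "X (Suc n) \<subseteq> X n" for n
    by (induction n) (use K0 mono in \<open>auto simp: X_def\<close>)
  then have dec: "decseq X" by (rule decseq_SucI)
  note A = hausdorff_dist_decseq_LIMSEQ[OF X dec, folded A_def]
  have "(\<lambda>n. hausdorff_dist (X (Suc n)) (\<Psi> A)) \<longlonglongrightarrow> 0"
  proof (rule tendsto_sandwich)
    show "\<forall>\<^sub>F n in sequentially. 0 \<le> hausdorff_dist (X (Suc n)) (\<Psi> A)"
      using X A cpt by (intro always_eventually allI hausdorff_dist_nonneg) auto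
    show "\<forall>\<^sub>F n in sequentially. hausdorff_dist (X (Suc n)) (\<Psi> A) \<le> c * hausdorff_dist (X n) A"
      using X A contr by (intro always_eventually allI) (auto simp: X_def)
    show "(\<lambda>n. c * hausdorff_dist (X n) A) \<longlonglongrightarrow> 0"
      using tendsto_mult[OF tendsto_const A(3), of c] by simp
  qed simp
  moreover have "(\<lambda>n. hausdorff_dist (X (Suc n)) A) \<longlonglongrightarrow> 0"
    using A(3) by (rule LIMSEQ_Suc)
  ultimately have fixpoint: "\<Psi> A = A"
    using X A cpt by (intro hausdorff_dist_LIMSEQ_unique[of "\<lambda>n. X (Suc n)"]) auto
  have "(\<lambda>n. hausdorff_dist ((\<Psi> ^^ n) K) A) \<longlonglongrightarrow> 0" if K: "compact K" "K \<noteq> {}" for K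
  proof (rule tendsto_sandwich)
    show "\<forall>\<^sub>F n in sequentially. 0 \<le> hausdorff_dist ((\<Psi> ^^ n) K) A"
      using iter[OF K] A by (intro always_eventually allI hausdorff_dist_nonneg) auto
    have "hausdorff_dist ((\<Psi> ^^ n) K) A \<le> c ^ n * hausdorff_dist K A" for n
    proof (induction n)
      case (Suc n)
      have "hausdorff_dist ((\<Psi> ^^ Suc n) K) A \<le> c * hausdorff_dist ((\<Psi> ^^ n) K) A"
        using contr[of "(\<Psi> ^^ n) K" A] iter[OF K] A by (simp add: fixpoint)
      also have "\<dots> \<le> c * (c ^ n * hausdorff_dist K A)"
        using Suc c by (intro mult_left_mono)
      finally show ?case by (simp add: mult.assoc)
    qed simp
    then show "\<forall>\<^sub>F n in sequentially. hausdorff_dist ((\<Psi> ^^ n) K) A \<le> c ^ n * hausdorff_dist K A"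
      by simp
    show "(\<lambda>n. c ^ n * hausdorff_dist K A) \<longlonglongrightarrow> 0"
      using c by (intro tendsto_mult_left_zero LIMSEQ_realpow_zero)
  qed simp
  moreover have "A \<subseteq> K0" unfolding A_def X_def by (rule INF_lower2[of 0]) auto
  ultimately show thesis using that A fixpoint by blast
qed

lemma hutchinson_mono: "K \<subseteq> K' \<Longrightarrow> hutchinson G K \<subseteq> hutchinson G K'"
  unfolding hutchinson_def by blast

lemma hutchinson_compact:
  fixes G :: "('a::metric_space \<Rightarrow> 'a) set"
  assumes "finite G" "G \<noteq> {}" "\<And>g. g \<in> G \<Longrightarrow> continuous_on UNIV g" "compact K" "K \<noteq> {}"
  shows "compact (hutchinson G K) \<and> hutchinson G K \<noteq> {}"
  using assms unfolding hutchinson_def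
  by (auto intro!: compact_UN compact_continuous_image intro: continuous_on_subset)

text \<open>The definite description in \<open>attractor\<close> denotes \<open>A\<close> because the iterates of a non-empty
  compact set have at most one compact limit.\<close>

lemma attractor_eqI:
  fixes G :: "('a::metric_space \<Rightarrow> 'a) set"
  assumes "finite G" "G \<noteq> {}" "\<And>g. g \<in> G \<Longrightarrow> continuous_on UNIV g" "is_attractor G A"
  shows "attractor G = A"
  unfolding attractor_def
proof (rule the_equality)
  show "is_attractor G A" by (fact assms)
next
  fix B assume B: "is_attractor G B"
  have "compact ((hutchinson G ^^ n) A) \<and> (hutchinson G ^^ n) A \<noteq> {}" for n
    using assms(4)
    by (induction n) (simp_all add: is_attractor_def hutchinson_compact[OF assms(1-3)])
  then show "B = A"
    using B assms(4) hausdorff_dist_LIMSEQ_unique[of "\<lambda>n. (hutchinson G ^^ n) A" B A]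
    by (auto simp: is_attractor_def)
qed


text \<open>Since \<open>A\<close> is compact, its distance from \<open>H\<close> is attained; at the extremal point it would
  have to shrink by the factor \<open>\<tau> < 1\<close>.\<close>

lemma contraction_subset:
  fixes A :: "'a::heine_borel set"
  assumes A: "compact A" "A \<subseteq> S \<union> h ` A"
    and H: "closed H" "H \<noteq> {}" "S \<subseteq> H" "h ` H \<subseteq> H"
    and h: "\<And>x y. dist (h x) (h y) \<le> \<tau> * dist x y" and \<tau>: "0 \<le> \<tau>" "\<tau> < 1"
  shows "A \<subseteq> H"
proof (cases "A = {}")
  case False
  obtain a where a: "a \<in> A" "\<And>b. b \<in> A \<Longrightarrow> infdist b H \<le> infdist a H"
    using continuous_attains_sup[OF A(1) False, of "\<lambda>x. infdist x H"]
    by (auto simp: continuous_on_infdist continuous_on_id)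
  have "infdist a H \<le> \<tau> * infdist a H"
  proof (cases "a \<in> S")
    case True
    then have "infdist a H = 0" using H(3) by auto
    then show ?thesis by simp
  next
    case False
    then obtain b where b: "b \<in> A" "a = h b" using a(1) A(2) by blast
    obtain y where y: "y \<in> H" "infdist b H = dist b y"
      using infdist_attains_inf[OF H(1,2)] by blast
    have "infdist a H \<le> dist (h b) (h y)"
      using b y(1) H(4) by (auto intro: infdist_le)
    also have "\<dots> \<le> \<tau> * infdist b H" using h y(2) by simp
    also have "\<dots> \<le> \<tau> * infdist a H" using a(2) b(1) \<tau>(1) by (intro mult_left_mono)
    finally show ?thesis .
  qed
  then have "(1 - \<tau>) * infdist a H \<le> 0" by (simp add: algebra_simps)
  then have "infdist a H \<le> 0" using \<tau>(2) by (simp add: mult_le_0_iff)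
  then have "infdist b H = 0" if "b \<in> A" for b
    using a(2)[OF that] infdist_nonneg[of b H] by linarith
  then show ?thesis using in_closed_iff_infdist_zero[OF H(1,2)] by blast
qed simp

section \<open>Families of real maps with a dominant member\<close>

lemma near_UN: "(\<And>i. i \<in> J \<Longrightarrow> near e (X i) (Y i)) \<Longrightarrow> near e (\<Union>i\<in>J. X i) (\<Union>i\<in>J. Y i)"
  unfolding near_def by blast

lemma near_Un: "near e A B \<Longrightarrow> near e A' B' \<Longrightarrow> near e (A \<union> A') (B \<union> B')"
  unfolding near_def by blast

lemma near_insert: "near e A B \<Longrightarrow> 0 \<le> e \<Longrightarrow> near e (insert x A) (insert x B)"
  unfolding near_def by auto

lemma near_convex_hull:
  fixes S T :: "'a::real_normed_vector set"
  assumes "near e S T"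
  shows "near e (convex hull S) (convex hull T)"
proof -
  let ?N = "\<Union>x\<in>convex hull T. \<Union>y\<in>cball 0 e. {x + y}"
  have "S \<subseteq> ?N"
  proof
    fix s assume "s \<in> S"
    then obtain t where t: "t \<in> T" "dist s t \<le> e" using assms by (elim nearE)
    then have "t \<in> convex hull T" "s - t \<in> cball 0 e" "s = t + (s - t)"
      by (auto simp: hull_inc dist_norm norm_minus_commute)
    then show "s \<in> ?N" by blast
  qed
  then have "convex hull S \<subseteq> ?N"
    by (intro hull_minimal convex_sums convex_convex_hull convex_cball)
  moreover have "\<exists>x\<in>convex hull T. dist a x \<le> e" if "a \<in> ?N" for a
  proof -
    from that obtain x y where "x \<in> convex hull T" "y \<in> cball 0 e" "a = x + y" by blast
    then show ?thesis by (intro bexI[of _ x]) (auto simp: dist_norm)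
  qed
  ultimately show ?thesis by (intro nearI) blast
qed

text \<open>The powers of \<open>\<tau>\<close> with exponents of one parity cut the unit interval into pieces no longer than
  \<open>1 - \<tau>\<^sup>2\<close>. Fixing the parity is what is needed for a map that changes sides at each step.\<close>

lemma power_near_unit_interval:
  fixes \<mu> \<tau> :: real
  assumes \<tau>: "0 < \<tau>" "\<tau> < 1" and \<mu>: "0 < \<mu>" "\<mu> \<le> 1" and j: "j \<le> (1::nat)"
  obtains l where "\<bar>\<mu> - \<tau> ^ (2 * l + j)\<bar> \<le> 1 - \<tau>\<^sup>2"
proof -
  let ?P = "\<lambda>l. \<tau> ^ (2 * l + j) \<le> \<mu>"
  obtain n where n: "\<tau> ^ n < \<mu>" using real_arch_pow_inv[OF \<mu>(1) \<tau>(2)] by blast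
  have "\<tau> ^ (2 * n + j) \<le> \<tau> ^ n" using \<tau> by (intro power_decreasing) auto
  then have "?P n" using n by linarith
  define l where "l = (LEAST l. ?P l)"
  have l: "?P l" unfolding l_def by (rule LeastI[of ?P, OF \<open>?P n\<close>])
  have sq: "\<tau>\<^sup>2 \<le> 1" using \<tau> by (simp add: power_le_one)
  have "\<mu> - \<tau> ^ (2 * l + j) \<le> 1 - \<tau>\<^sup>2"
  proof (cases l)
    case 0
    have "\<tau>\<^sup>2 \<le> \<tau> ^ j" using \<tau> j by (intro power_decreasing) auto
    then show ?thesis using 0 \<mu> by simp
  next
    case (Suc l')
    then have "\<not> ?P l'" using not_less_Least[of l' ?P] l_def by auto
    then have "\<mu> - \<tau> ^ (2 * l + j) \<le> \<tau> ^ (2 * l' + j) * (1 - \<tau>\<^sup>2)"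
      by (simp add: Suc algebra_simps power_add power2_eq_square)
    also have "\<dots> \<le> 1 * (1 - \<tau>\<^sup>2)"
      using \<tau> sq by (intro mult_right_mono power_le_one) auto
    finally show ?thesis by simp
  qed
  with l show thesis by (intro that[of l]) auto
qed

text \<open>The members are \<open>x \<mapsto> p i + t m i (x - p i)\<close>, the normal form of a semi-linear family on the
  line. A member may be listed under several indices, so an index other than \<open>k\<close> need not be
  strictly dominated; it may also be a copy of \<open>k\<close>.\<close>

locale dominated_family =
  fixes J :: "'i set" and m p :: "'i \<Rightarrow> real" and k :: 'i and c :: real
  assumes finite_J: "finite J" and k_in: "k \<in> J" and mk: "m k \<noteq> 0"
    and c_nonneg: "0 \<le> c" and c_less: "c < 1"
    and dominated: "\<And>i. i \<in> J \<Longrightarrow> \<bar>m i\<bar> \<le> c * \<bar>m k\<bar> \<or> (m i = m k \<and> p i = p k)"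
begin

definition g :: "real \<Rightarrow> 'i \<Rightarrow> real \<Rightarrow> real" where
  "g t i x = p i + t * m i * (x - p i)"

definition r :: real where "r = \<bar>m k\<bar>"

text \<open>The dominated indices; neither \<open>k\<close> nor its copies belong to this set.\<close>

definition I :: "'i set" where "I = {i \<in> J. \<bar>m i\<bar> \<le> c * r}"

text \<open>With \<open>Q\<close> the largest distance of a fixed point from \<open>p k\<close>, the radius \<open>R\<close> solves
  \<open>c (R + Q) + Q = R\<close>. This makes the interval invariant under all members for all parameters up
  to and including the critical one (\<open>g_K0\<close>), so that it bounds all attractors at once.\<close>

definition K0 :: "real set" where
  "K0 = cball (p k) ((1 + c) * Max ((\<lambda>i. \<bar>p i - p k\<bar>) ` J) / (1 - c))"

text \<open>The part of an attractor from which the dominant map generates the rest; see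
  \<open>attractor_decomposition\<close>.\<close>

definition parts :: "real \<Rightarrow> real set \<Rightarrow> real set" where
  "parts t K = insert (p k) (\<Union>i\<in>I. g t i ` K)"

text \<open>At the critical parameter \<open>1 / r\<close> the dominant map is the identity or the reflection at \<open>p k\<close>.
  If \<open>S\<close> contains \<open>p k\<close>, this hull is the set that the orbits of \<open>S\<close> fill up in the limit.\<close>

definition sweep :: "real set \<Rightarrow> real set" where
  "sweep S = convex hull (S \<union> g (1 / r) k ` S)"

lemma r_pos: "0 < r" using mk by (simp add: r_def)

lemma I_subset: "I \<subseteq> J" by (auto simp: I_def)

lemma finite_I: "finite I" using finite_J I_subset by (rule rev_finite_subset)

lemma m_le: "i \<in> J \<Longrightarrow> \<bar>m i\<bar> \<le> r"
  using dominated[of i] c_less mult_right_mono[of c 1 r] by (auto simp: r_def)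

lemma g_outside_I: "i \<in> J \<Longrightarrow> i \<notin> I \<Longrightarrow> g t i = g t k"
  using dominated[of i] by (auto simp: I_def r_def g_def fun_eq_iff)

lemma hutchinson_eq_parts:
  "insert (p k) (hutchinson (g t ` J) K) = parts t K \<union> g t k ` K"
proof -
  have "hutchinson (g t ` J) K = (\<Union>i\<in>I. g t i ` K) \<union> g t k ` K"
    using I_subset k_in by (auto simp: hutchinson_def) (metis g_outside_I image_eqI)
  then show ?thesis by (simp add: parts_def)
qed

lemma dist_g: "dist (g t i x) (g t i y) = \<bar>t\<bar> * \<bar>m i\<bar> * dist x y"
  by (simp add: g_def dist_real_def flip: abs_mult) (simp add: algebra_simps)

lemma continuous_g: "continuous_on S (g t i)"
  unfolding g_def by (intro continuous_intros)

lemma compact_g_image: "compact K \<Longrightarrow> compact (g t i ` K)"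
  by (intro compact_continuous_image continuous_g)

lemma near_g_image:
  assumes "near e K K'" "\<bar>t\<bar> * \<bar>m i\<bar> \<le> d" "0 \<le> e"
  shows "near (d * e) (g t i ` K) (g t i ` K')"
proof (rule nearI)
  fix a assume "a \<in> g t i ` K"
  then obtain x where x: "x \<in> K" "a = g t i x" by blast
  then obtain y where y: "y \<in> K'" "dist x y \<le> e" using assms(1) by (elim nearE)
  have "dist a (g t i y) \<le> d * e"
    unfolding x(2) dist_g using assms y(2) order_trans[OF _ assms(2), of 0]
    by (intro mult_mono) auto
  then show "\<exists>b\<in>g t i ` K'. dist a b \<le> d * e" using y(1) by blast
qed

lemma K0: "compact K0" "K0 \<noteq> {}" "p k \<in> K0" "convex K0"
proof -
  have "\<bar>p k - p k\<bar> \<le> Max ((\<lambda>i. \<bar>p i - p k\<bar>) ` J)"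
    using finite_J k_in by (intro Max_ge) auto
  then have "0 \<le> (1 + c) * Max ((\<lambda>i. \<bar>p i - p k\<bar>) ` J) / (1 - c)"
    using c_nonneg c_less by simp
  then show "p k \<in> K0" by (simp add: K0_def)
  then show "K0 \<noteq> {}" by blast
qed (auto simp: K0_def)

lemma scale_le:
  assumes "0 \<le> t" "t \<le> 1 / r" "\<bar>m i\<bar> \<le> d * r" "0 \<le> d"
  shows "t * \<bar>m i\<bar> \<le> d"
proof -
  have "t * \<bar>m i\<bar> \<le> (1 / r) * (d * r)"
    using assms r_pos by (intro mult_mono) auto
  then show ?thesis using r_pos by simp
qed

lemma g_K0:
  assumes "0 \<le> t" "t \<le> 1 / r" "i \<in> J"
  shows "g t i ` K0 \<subseteq> K0"
proof
  define Q where "Q = Max ((\<lambda>i. \<bar>p i - p k\<bar>) ` J)"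
  define R where "R = (1 + c) * Q / (1 - c)"
  have KR: "x \<in> K0 \<longleftrightarrow> \<bar>x - p k\<bar> \<le> R" for x
    by (auto simp: K0_def R_def Q_def dist_real_def abs_minus_commute)
  have Q: "\<bar>p i - p k\<bar> \<le> Q" using finite_J assms(3) by (auto simp: Q_def)
  fix y assume "y \<in> g t i ` K0"
  then obtain x where x: "\<bar>x - p k\<bar> \<le> R" "y = g t i x" by (auto simp: KR)
  have "\<bar>y - p k\<bar> \<le> R"
  proof (cases "i \<in> I")
    case True
    then have tm: "t * \<bar>m i\<bar> \<le> c"
      using scale_le[OF assms(1,2)] c_nonneg by (simp add: I_def)
    have "\<bar>y - p k\<bar> \<le> \<bar>p i - p k\<bar> + \<bar>t * m i * (x - p i)\<bar>"
      unfolding x(2) g_def by linarith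
    also have "\<bar>t * m i * (x - p i)\<bar> = t * \<bar>m i\<bar> * \<bar>x - p i\<bar>"
      using assms(1) by (simp add: abs_mult)
    also have "\<dots> \<le> c * (R + Q)"
      using tm x(1) Q assms(1) c_nonneg by (intro mult_mono) auto
    also have "\<bar>p i - p k\<bar> + c * (R + Q) \<le> Q + c * (R + Q)" using Q by simp
    also have "\<dots> = R" using c_less by (simp add: R_def field_simps)
    finally show ?thesis by simp
  next
    case False
    have "\<bar>y - p k\<bar> = t * \<bar>m k\<bar> * \<bar>x - p k\<bar>"
      unfolding x(2) g_outside_I[OF assms(3) False] using assms(1) by (simp add: g_def abs_mult)
    also have "\<dots> \<le> 1 * \<bar>x - p k\<bar>"
      using scale_le[OF assms(1,2), of k 1] by (intro mult_right_mono) (auto simp: r_def)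
    finally show ?thesis using x(1) by simp
  qed
  then show "y \<in> K0" by (simp add: KR)
qed

subsection \<open>The attractors below the critical parameter\<close>

lemma maps_compact: "compact K \<Longrightarrow> K \<noteq> {} \<Longrightarrow>
    compact (hutchinson (g t ` J) K) \<and> hutchinson (g t ` J) K \<noteq> {}"
  using finite_J k_in by (intro hutchinson_compact) (auto simp: continuous_g)

lemma hausdorff_dist_hutchinson:
  assumes t: "0 \<le> t" and K: "compact K" "K \<noteq> {}" "compact K'" "K' \<noteq> {}"
  shows "hausdorff_dist (hutchinson (g t ` J) K) (hutchinson (g t ` J) K')
    \<le> t * r * hausdorff_dist K K'"
proof -
  have "near (t * r * hausdorff_dist K K') (hutchinson (g t ` J) X) (hutchinson (g t ` J) Y)"
    if "near (hausdorff_dist K K') X Y" for X Y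
    unfolding hutchinson_def SUP_image comp_def
    using that t m_le hausdorff_dist_nonneg[OF K]
    by (intro near_UN near_g_image mult_mono) auto
  then show ?thesis
    using near_hausdorff_dist[OF K] maps_compact[OF K(1,2)] maps_compact[OF K(3,4)]
    by (simp add: hausdorff_dist_le_iff)
qed

lemma attractor_maps:
  fixes t :: real
  assumes t: "0 \<le> t" "t < 1 / r"
  defines "A \<equiv> attractor (g t ` J)"
  shows "compact A" "A \<noteq> {}" "A \<subseteq> K0" "hutchinson (g t ` J) A = A"
proof -
  have tr: "t * r < 1" "0 \<le> t * r" using t r_pos by (auto simp: field_simps)
  have inv: "hutchinson (g t ` J) K0 \<subseteq> K0"
    using g_K0[OF t(1)] t(2) by (force simp: hutchinson_def)
  obtain B where B: "compact B" "B \<noteq> {}" "B \<subseteq> K0" "hutchinson (g t ` J) B = B"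
    "\<And>K. compact K \<Longrightarrow> K \<noteq> {} \<Longrightarrow>
      (\<lambda>n. hausdorff_dist ((hutchinson (g t ` J) ^^ n) K) B) \<longlonglongrightarrow> 0"
    by (rule set_contraction_attractor[OF tr(2,1) maps_compact hutchinson_mono
          hausdorff_dist_hutchinson[OF t(1)] K0(1,2) inv]) (assumption | rule that | blast)+
  have "A = B"
    unfolding A_def using finite_J k_in B
    by (intro attractor_eqI) (auto simp: continuous_g is_attractor_def)
  then show "compact A" "A \<noteq> {}" "A \<subseteq> K0" "hutchinson (g t ` J) A = A" using B by auto
qed

text \<open>The dominant map is a contraction here, and the attractor is a non-empty closed set that it
  maps into itself, so it contains the fixed point of that map.\<close>

lemma p_in_attractor:
  assumes t: "0 \<le> t" "t < 1 / r"
  shows "p k \<in> attractor (g t ` J)"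
proof -
  note A = attractor_maps[OF t]
  have "{p k} \<subseteq> attractor (g t ` J)"
  proof (rule contraction_subset[where S = "{}" and h = "g t k" and \<tau> = "t * r"])
    show "g t k ` attractor (g t ` J) \<subseteq> attractor (g t ` J)"
      using A(4) k_in by (auto simp: hutchinson_def)
    show "dist (g t k x) (g t k y) \<le> t * r * dist x y" for x y
      using t by (simp add: dist_g r_def)
    show "t * r < 1" "0 \<le> t * r" using t r_pos by (auto simp: field_simps)
    show "{p k} \<subseteq> {} \<union> g t k ` {p k}" by (simp add: g_def)
  qed (use A in \<open>auto simp: compact_imp_closed\<close>)
  then show ?thesis by simp
qed

lemma attractor_decomposition:
  assumes t: "0 \<le> t" "t < 1 / r"
  shows "attractor (g t ` J) = parts t (attractor (g t ` J)) \<union> g t k ` attractor (g t ` J)"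
proof -
  let ?A = "attractor (g t ` J)"
  have "?A = insert (p k) ?A" using p_in_attractor[OF t] by (simp add: insert_absorb)
  also have "\<dots> = insert (p k) (hutchinson (g t ` J) ?A)" by (simp only: attractor_maps(4)[OF t])
  finally show ?thesis by (simp only: hutchinson_eq_parts)
qed

subsection \<open>The limit set\<close>

lemma g_crit: "g (1 / r) k x = p k + sgn (m k) * (x - p k)"
  using mk by (auto simp: g_def r_def sgn_if)

lemma g_crit_involution: "g (1 / r) k (g (1 / r) k x) = x"
  using mk by (simp add: g_crit sgn_if)

lemma g_crit_sweep: "g (1 / r) k ` sweep S = sweep S"
proof -
  have "g (1 / r) k = (\<lambda>x. (p k - sgn (m k) * p k) + sgn (m k) *\<^sub>R x)"
    by (simp add: g_crit fun_eq_iff algebra_simps)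
  then have "g (1 / r) k ` sweep S = convex hull (g (1 / r) k ` (S \<union> g (1 / r) k ` S))"
    by (simp only: sweep_def convex_hull_affinity)
  also have "g (1 / r) k ` (S \<union> g (1 / r) k ` S) = S \<union> g (1 / r) k ` S"
    by (simp add: image_Un image_image g_crit_involution Un_commute)
  finally show ?thesis by (simp add: sweep_def)
qed

text \<open>The value of \<open>g t k\<close> is a convex combination of \<open>p k\<close> and of the value of the critical
  isometry \<open>g (1 / r) k\<close>, which preserves the hull.\<close>

lemma g_sweep_subset:
  assumes "0 \<le> t" "t \<le> 1 / r" "p k \<in> S"
  shows "g t k ` sweep S \<subseteq> sweep S"
proof
  fix y assume "y \<in> g t k ` sweep S"
  then obtain x where x: "x \<in> sweep S" "y = g t k x" by blast
  have "y = (1 - t * r) *\<^sub>R p k + (t * r) *\<^sub>R g (1 / r) k x"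
    unfolding x(2) using r_pos by (simp add: g_def field_simps)
  moreover have "p k \<in> sweep S" using assms(3) by (simp add: sweep_def hull_inc)
  moreover have "g (1 / r) k x \<in> sweep S" using x(1) g_crit_sweep by blast
  moreover have "0 \<le> t * r" "t * r \<le> 1" using assms r_pos by (auto simp: field_simps)
  ultimately show "y \<in> sweep S"
    using convexD[of "sweep S" "p k" "g (1 / r) k x" "1 - t * r" "t * r"]
    by (simp add: sweep_def)
qed

lemma near_sweep:
  assumes "near e S S'" "0 \<le> e"
  shows "near e (sweep S) (sweep S')"
proof -
  have "near (1 * e) (g (1 / r) k ` S) (g (1 / r) k ` S')"
    using assms mk by (intro near_g_image) (auto simp: r_def)
  then show ?thesis
    unfolding sweep_def using assms by (intro near_convex_hull near_Un) auto
qed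

lemma compact_parts: "compact K \<Longrightarrow> compact (parts t K)"
  unfolding parts_def using finite_I by (intro compact_insert compact_UN compact_g_image)

lemma compact_sweep: "compact S \<Longrightarrow> compact (sweep S)"
  unfolding sweep_def by (intro compact_convex_hull compact_Un compact_g_image)

lemma sweep_parts_ne: "sweep (parts t K) \<noteq> {}"
  by (auto simp: sweep_def parts_def)

lemma near_parts:
  assumes "near e K K'" "0 \<le> e"
  shows "near (c * e) (parts (1 / r) K) (parts (1 / r) K')"
  unfolding parts_def using assms r_pos c_nonneg
  by (intro near_insert near_UN near_g_image) (auto simp: I_def field_simps)

text \<open>Taking hulls and applying the critical isometry do not increase distances, and only the
  dominated members act on \<open>K\<close> itself.\<close>

lemma hausdorff_dist_limit_operator:
  assumes K: "compact K" "K \<noteq> {}" "compact K'" "K' \<noteq> {}"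
  shows "hausdorff_dist (sweep (parts (1 / r) K)) (sweep (parts (1 / r) K')) \<le> c * hausdorff_dist K K'"
  using near_hausdorff_dist[OF K] hausdorff_dist_nonneg[OF K] c_nonneg
  by (auto simp: hausdorff_dist_le_iff K compact_sweep compact_parts sweep_parts_ne
      intro!: near_sweep near_parts)

lemma limit_set_exists:
  obtains L where "compact L" "L \<noteq> {}" "sweep (parts (1 / r) L) = L"
proof -
  have "parts (1 / r) K0 \<subseteq> K0"
    using g_K0[of "1 / r"] K0(3) I_subset r_pos by (fastforce simp: parts_def)
  then have "parts (1 / r) K0 \<union> g (1 / r) k ` parts (1 / r) K0 \<subseteq> K0"
    using g_K0[of "1 / r" k] k_in r_pos by fastforce
  then have inv: "sweep (parts (1 / r) K0) \<subseteq> K0"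
    unfolding sweep_def using K0(4) by (rule hull_minimal)
  have mono: "sweep (parts (1 / r) K) \<subseteq> sweep (parts (1 / r) K')" if "K \<subseteq> K'" for K K'
    unfolding sweep_def parts_def using that by (intro hull_mono) blast
  have cpt: "compact (sweep (parts (1 / r) K)) \<and> sweep (parts (1 / r) K) \<noteq> {}"
    if "compact K" for K
    using that by (simp add: compact_sweep compact_parts sweep_parts_ne)
  show thesis
    by (rule set_contraction_attractor[where \<Psi> = "\<lambda>K. sweep (parts (1 / r) K)",
          OF c_nonneg c_less cpt mono hausdorff_dist_limit_operator K0(1,2) inv])
      (use that in blast)+
qed

subsection \<open>Convergence to the limit set\<close>

lemma attractor_subset_sweep:
  assumes t: "0 \<le> t" "t < 1 / r"
  defines "A \<equiv> attractor (g t ` J)"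
  shows "A \<subseteq> sweep (parts t A)"
proof (rule contraction_subset[where h = "g t k" and \<tau> = "t * r"])
  note A = attractor_maps[OF t, folded A_def]
  show "compact A" by (fact A)
  show "A \<subseteq> parts t A \<union> g t k ` A"
    unfolding A_def using attractor_decomposition[OF t] by (rule equalityD1)
  show "closed (sweep (parts t A))"
    using A by (intro compact_imp_closed compact_sweep compact_parts)
  show "parts t A \<subseteq> sweep (parts t A)" by (auto simp: sweep_def hull_inc)
  show "g t k ` sweep (parts t A) \<subseteq> sweep (parts t A)"
    using t by (intro g_sweep_subset) (auto simp: parts_def)
  show "dist (g t k x) (g t k y) \<le> t * r * dist x y" for x y
    using t by (simp add: dist_g r_def)
  show "t * r < 1" "0 \<le> t * r" using t r_pos by (auto simp: field_simps)
qed (rule sweep_parts_ne)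

text \<open>This is where dimension one enters: the convex hull of a set of reals containing \<open>p k\<close> is the
  union of the segments from \<open>p k\<close> to points of that set.\<close>

lemma sweep_segment:
  assumes "x \<in> sweep S" "p k \<in> S"
  obtains y \<mu> where "y \<in> S \<union> g (1 / r) k ` S" "0 \<le> \<mu>" "\<mu> \<le> 1" "x - p k = \<mu> * (y - p k)"
proof -
  let ?T = "S \<union> g (1 / r) k ` S"
  have x: "x \<in> convex hull ?T" using assms(1) by (simp add: sweep_def)
  have "\<exists>y\<in>?T. x \<le> y"
  proof (rule ccontr)
    assume "\<not> (\<exists>y\<in>?T. x \<le> y)"
    then have "convex hull ?T \<subseteq> {..<x}"
      by (intro hull_minimal) (auto simp: not_le)
    then show False using x by blast
  qed
  then obtain y1 where y1: "y1 \<in> ?T" "x \<le> y1" by blast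
  have "\<exists>y\<in>?T. y \<le> x"
  proof (rule ccontr)
    assume "\<not> (\<exists>y\<in>?T. y \<le> x)"
    then have "convex hull ?T \<subseteq> {x<..}"
      by (intro hull_minimal) (auto simp: not_le)
    then show False using x by blast
  qed
  then obtain y2 where y2: "y2 \<in> ?T" "y2 \<le> x" by blast
  consider "x = p k" | "p k < x" | "x < p k" by linarith
  then show thesis
  proof cases
    case 1
    then show thesis by (intro that[of "p k" 0]) (use assms(2) in auto)
  next
    case 2
    then show thesis by (intro that[of y1 "(x - p k) / (y1 - p k)"]) (use y1 in auto)
  next
    case 3
    then show thesis
      by (intro that[of y2 "(x - p k) / (y2 - p k)"])
        (use y2 in \<open>auto intro: divide_nonpos_nonpos simp: divide_le_eq\<close>)
  qed
qed

text \<open>Every point of the hull lies between \<open>p k\<close> and a point \<open>y\<close> that is in \<open>S = parts t A\<close> or is the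
  critical image of some \<open>s \<in> S\<close>. The orbit of \<open>s\<close> under the dominant map stays in \<open>A\<close>; those of
  its points that lie on the side of \<open>y\<close> leave gaps of relative size at most \<open>1 - (t r)\<^sup>2\<close>.\<close>

lemma near_sweep_attractor:
  assumes t: "0 < t" "t < 1 / r"
  defines "A \<equiv> attractor (g t ` J)"
  shows "near ((1 - (t * r)\<^sup>2) * diameter K0) (sweep (parts t A)) A"
proof (rule nearI)
  have t': "0 \<le> t" using t by simp
  have tr: "0 < t * r" "t * r < 1" using t r_pos by (auto simp: field_simps)
  note A = attractor_maps[OF t' t(2), folded A_def]
  have dec: "A = parts t A \<union> g t k ` A"
    unfolding A_def by (rule attractor_decomposition[OF t' t(2)])
  fix x assume "x \<in> sweep (parts t A)"
  then obtain y \<mu> where y: "y \<in> parts t A \<union> g (1 / r) k ` parts t A"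
    and \<mu>: "0 \<le> \<mu>" "\<mu> \<le> 1" "x - p k = \<mu> * (y - p k)"
    by (rule sweep_segment) (auto simp: parts_def)
  \<comment> \<open>The parity \<open>j\<close> records whether \<open>y\<close> is itself in \<open>parts t A\<close> or a critical image: the visits
    of the orbit of \<open>s\<close> to the side of \<open>y\<close> are those at times \<open>2 * l + j\<close>.\<close>
  obtain s and j :: nat where s: "s \<in> parts t A" "j \<le> 1" "y - p k = sgn (m k) ^ j * (s - p k)"
  proof (cases "y \<in> parts t A")
    case True
    then show thesis using that[of y 0] by simp
  next
    case False
    then obtain s where "s \<in> parts t A" "y = g (1 / r) k s" using y by blast
    then show thesis using that[of s 1] by (simp add: g_crit)
  qed
  have sA: "s \<in> A" using s(1) dec by blast
  have it: "p k + (t * m k) ^ n * (s - p k) \<in> A" for n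
  proof (induction n)
    case (Suc n)
    then have "g t k (p k + (t * m k) ^ n * (s - p k)) \<in> A" using dec by blast
    then show ?case by (simp add: g_def mult_ac)
  qed (use sA in simp)
  show "\<exists>a\<in>A. dist x a \<le> (1 - (t * r)\<^sup>2) * diameter K0"
  proof (cases "\<mu> = 0")
    case True
    then have "x = p k" using \<mu> by simp
    moreover have "p k \<in> A" using dec by (auto simp: parts_def)
    moreover have "0 \<le> (1 - (t * r)\<^sup>2) * diameter K0"
      using tr K0(1) by (intro mult_nonneg_nonneg diameter_ge_0 compact_imp_bounded)
        (auto simp: power_le_one)
    ultimately show ?thesis by (intro bexI[of _ "p k"]) auto
  next
    case False
    then obtain l where l: "\<bar>\<mu> - (t * r) ^ (2 * l + j)\<bar> \<le> 1 - (t * r)\<^sup>2"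
      using power_near_unit_interval[OF tr _ \<mu>(2) s(2)] \<mu>(1) by auto
    let ?a = "p k + (t * m k) ^ (2 * l + j) * (s - p k)"
    have "t * m k = t * r * sgn (m k)" by (simp add: r_def abs_mult_sgn mult.assoc)
    then have "(t * m k) ^ (2 * l + j) = (t * r) ^ (2 * l + j) * sgn (m k) ^ (2 * l + j)"
      by (simp only: power_mult_distrib)
    also have "sgn (m k) ^ (2 * l + j) = sgn (m k) ^ j"
      using mk by (simp add: power_add power_mult sgn_if)
    finally have pow: "(t * m k) ^ (2 * l + j) = (t * r) ^ (2 * l + j) * sgn (m k) ^ j" .
    have "x - ?a = (x - p k) - (t * m k) ^ (2 * l + j) * (s - p k)" by simp
    also have "\<dots> = (\<mu> - (t * r) ^ (2 * l + j)) * (sgn (m k) ^ j * (s - p k))"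
      unfolding pow \<mu>(3) s(3) by (simp only: left_diff_distrib mult.assoc)
    finally have "dist x ?a = \<bar>\<mu> - (t * r) ^ (2 * l + j)\<bar> * \<bar>s - p k\<bar>"
      using mk by (simp add: dist_real_def abs_mult power_abs)
    also have "\<dots> \<le> (1 - (t * r)\<^sup>2) * diameter K0"
    proof (rule mult_mono[OF l])
      show "\<bar>s - p k\<bar> \<le> diameter K0"
        using diameter_bounded_bound[of K0 s "p k"] sA A(3) K0
        by (auto simp: dist_real_def compact_imp_bounded)
    qed (use tr in \<open>auto simp: power_le_one\<close>)
    finally show ?thesis using it by blast
  qed
qed

lemma near_g_param:
  assumes "K \<subseteq> K0" "i \<in> J"
  shows "near (\<bar>s - t\<bar> * r * diameter K0) (g s i ` K) (g t i ` K)"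
proof (rule nearI)
  have "p i \<in> K0"
    using g_K0[of 0 i] assms(2) r_pos K0(3) by (force simp: g_def)
  fix a assume "a \<in> g s i ` K"
  then obtain x where x: "x \<in> K" "a = g s i x" by blast
  have "dist a (g t i x) = \<bar>s - t\<bar> * \<bar>m i\<bar> * \<bar>x - p i\<bar>"
    by (simp add: x(2) g_def dist_real_def flip: abs_mult) (simp add: algebra_simps)
  also have "\<dots> \<le> \<bar>s - t\<bar> * r * diameter K0"
  proof (intro mult_mono m_le assms(2))
    show "\<bar>x - p i\<bar> \<le> diameter K0"
      using diameter_bounded_bound[of K0 x "p i"] x(1) assms(1) K0 \<open>p i \<in> K0\<close>
      by (auto simp: dist_real_def compact_imp_bounded)
  qed (use r_pos in auto)
  finally show "\<exists>b\<in>g t i ` K. dist a b \<le> \<bar>s - t\<bar> * r * diameter K0"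
    using x(1) by blast
qed

lemma diameter_K0: "0 \<le> diameter K0"
  using K0(1) by (intro diameter_ge_0 compact_imp_bounded)

lemma near_sweep_parts_param:
  assumes "K \<subseteq> K0"
  shows "near (\<bar>s - t\<bar> * r * diameter K0) (sweep (parts s K)) (sweep (parts t K))"
  unfolding parts_def using assms I_subset r_pos diameter_K0
  by (intro near_sweep near_insert near_UN near_g_param) auto

text \<open>The numerator bounds the distance from \<open>A\<close> to its image under the contraction with fixed
  point \<open>L\<close>: the first summand is the density of \<open>A\<close> in its hull, the second the
  effect of replacing \<open>t\<close> by the critical parameter in the dominated members.\<close>

lemma attractor_limit_bound:
  assumes t: "0 < t" "t < 1 / r"
    and L: "compact L" "L \<noteq> {}" "sweep (parts (1 / r) L) = L"
  defines "A \<equiv> attractor (g t ` J)"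
  shows "hausdorff_dist A L
    \<le> ((1 - (t * r)\<^sup>2) * diameter K0 + (1 / r - t) * r * diameter K0) / (1 - c)"
proof -
  let ?W = "sweep (parts (1 / r) A)"
  let ?e = "(1 - (t * r)\<^sup>2) * diameter K0" and ?d = "(1 / r - t) * r * diameter K0"
  have t': "0 \<le> t" using t by simp
  have tr: "0 < t * r" "t * r < 1" using t r_pos by (auto simp: field_simps)
  note A = attractor_maps[OF t' t(2), folded A_def]
  have W: "compact ?W" "?W \<noteq> {}"
    using A by (auto simp: compact_sweep compact_parts sweep_parts_ne)
  have "0 \<le> ?e"
    using tr diameter_K0 by (intro mult_nonneg_nonneg) (auto simp: power_le_one)
  then have "near ?e A (sweep (parts t A))"
    using attractor_subset_sweep[OF t' t(2)] by (intro near_subset) (simp_all add: A_def)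
  moreover have "near ?d (sweep (parts t A)) ?W" "near ?d ?W (sweep (parts t A))"
    using near_sweep_parts_param[OF A(3), of t "1 / r"]
      near_sweep_parts_param[OF A(3), of "1 / r" t] t by auto
  moreover have "near ?e (sweep (parts t A)) A"
    using near_sweep_attractor[OF t] by (simp add: A_def)
  ultimately have "near (?e + ?d) A ?W" "near (?d + ?e) ?W A"
    by (auto intro: near_trans)
  then have "hausdorff_dist A ?W \<le> ?e + ?d"
    using A W by (simp add: hausdorff_dist_le_iff add.commute)
  moreover have "hausdorff_dist ?W L \<le> c * hausdorff_dist A L"
    using hausdorff_dist_limit_operator[OF A(1,2) L(1,2)] L(3) by simp
  ultimately have "hausdorff_dist A L \<le> ?e + ?d + c * hausdorff_dist A L"
    using hausdorff_dist_triangle[OF A(1,2) W L(1,2)] by linarith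
  then have "hausdorff_dist A L * (1 - c) \<le> ?e + ?d" by (simp add: algebra_simps)
  then show ?thesis using c_less by (simp add: pos_le_divide_eq)
qed

lemma attractor_tendsto:
  assumes L: "compact L" "L \<noteq> {}" "sweep (parts (1 / r) L) = L"
  shows "((\<lambda>t. hausdorff_dist (attractor (g t ` J)) L) \<longlongrightarrow> 0) (at_left (1 / r))"
proof (rule tendsto_sandwich)
  let ?b = "\<lambda>t. ((1 - (t * r)\<^sup>2) * diameter K0 + (1 / r - t) * r * diameter K0) / (1 - c)"
  have ev: "\<forall>\<^sub>F t in at_left (1 / r). 0 < t \<and> t < 1 / r"
    using r_pos eventually_at_left_real[of 0 "1 / r"] by simp
  show "\<forall>\<^sub>F t in at_left (1 / r). 0 \<le> hausdorff_dist (attractor (g t ` J)) L"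
    using ev by eventually_elim (intro hausdorff_dist_nonneg attractor_maps L; simp)
  show "\<forall>\<^sub>F t in at_left (1 / r). hausdorff_dist (attractor (g t ` J)) L \<le> ?b t"
    using ev by eventually_elim (intro attractor_limit_bound L; simp)
  have "isCont ?b (1 / r)" using c_less by (intro continuous_intros) auto
  from tendsto_within_subset[OF isContD[OF this] subset_UNIV]
  show "(?b \<longlongrightarrow> 0) (at_left (1 / r))" using r_pos by simp
qed simp

text \<open>Compare \<open>A\<^sub>s = F\<^sub>s A\<^sub>s\<close> with \<open>A\<^sub>t = F\<^sub>t A\<^sub>t\<close>
  through \<open>F\<^sub>s A\<^sub>t\<close>, where \<open>F\<^sub>t\<close> is the Hutchinson operator.\<close>

lemma attractor_lipschitz:
  assumes s: "0 \<le> s" "s < 1 / r" and t: "0 \<le> t" "t < 1 / r"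
  shows "hausdorff_dist (attractor (g s ` J)) (attractor (g t ` J))
    \<le> \<bar>s - t\<bar> * r * diameter K0 / (1 - s * r)"
proof -
  let ?A = "attractor (g s ` J)" and ?B = "attractor (g t ` J)"
  let ?F = "\<lambda>t. hutchinson (g t ` J)" and ?d = "\<bar>s - t\<bar> * r * diameter K0"
  note A = attractor_maps[OF s] and B = attractor_maps[OF t]
  have FB: "compact (?F s ?B)" "?F s ?B \<noteq> {}" using maps_compact[OF B(1,2)] by auto
  have "near ?d (?F s ?B) (?F t ?B)" "near ?d (?F t ?B) (?F s ?B)"
    unfolding hutchinson_def SUP_image comp_def
    using near_g_param[OF B(3), of _ s t] near_g_param[OF B(3), of _ t s]
    by (auto intro!: near_UN simp: abs_minus_commute)
  then have "hausdorff_dist (?F s ?B) ?B \<le> ?d"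
    using FB B by (simp add: hausdorff_dist_le_iff)
  moreover have "hausdorff_dist ?A (?F s ?B) \<le> s * r * hausdorff_dist ?A ?B"
    using hausdorff_dist_hutchinson[OF s(1) A(1,2) B(1,2)] A(4) by simp
  ultimately have "hausdorff_dist ?A ?B \<le> s * r * hausdorff_dist ?A ?B + ?d"
    using hausdorff_dist_triangle[OF A(1,2) FB B(1,2)] by linarith
  then have "hausdorff_dist ?A ?B * (1 - s * r) \<le> ?d" by (simp add: algebra_simps)
  moreover have "0 < 1 - s * r" using s r_pos by (simp add: field_simps)
  ultimately show ?thesis by (simp add: pos_le_divide_eq)
qed

text \<open>Two parameters close to the critical one are compared through \<open>L\<close>. If one of them is bounded
  away from it by \<open>b\<close>, the Lipschitz bound for that parameter has the constant
  \<open>r diameter K0 / (1 - b r)\<close>, whatever the other parameter is.\<close>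

lemma attractor_uniformly_continuous:
  assumes "0 < e"
  obtains d where "0 < d"
    "\<And>s t. 0 < s \<Longrightarrow> s < 1 / r \<Longrightarrow> 0 < t \<Longrightarrow> t < 1 / r \<Longrightarrow> \<bar>s - t\<bar> < d \<Longrightarrow>
      hausdorff_dist (attractor (g s ` J)) (attractor (g t ` J)) < e"
proof -
  let ?A = "\<lambda>t. attractor (g t ` J)"
  obtain L where L: "compact L" "L \<noteq> {}" "sweep (parts (1 / r) L) = L"
    by (rule limit_set_exists)
  have "\<forall>\<^sub>F t in at_left (1 / r). hausdorff_dist (?A t) L < e / 2"
    using attractor_tendsto[OF L] assms by (intro order_tendstoD(2)[of _ 0]) auto
  then obtain b where b: "b < 1 / r"
    "\<And>t. b < t \<Longrightarrow> t < 1 / r \<Longrightarrow> hausdorff_dist (?A t) L < e / 2"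
    by (metis (no_types, lifting) eventually_at_left_field)
  \<comment> \<open>The summand \<open>1\<close> keeps \<open>C\<close> positive when \<open>K0\<close> is a single point.\<close>
  define C where "C = r * diameter K0 + 1"
  have C: "0 < C" using r_pos diameter_K0 by (simp add: C_def add_nonneg_pos)
  have br: "0 < 1 - b * r" using b(1) r_pos by (simp add: field_simps)
  have low: "hausdorff_dist (?A s) (?A t) < e"
    if s: "0 < s" "s < 1 / r" "s \<le> b" and t: "0 < t" "t < 1 / r"
      and d: "\<bar>s - t\<bar> < e * (1 - b * r) / C" for s t
  proof -
    have "s * r \<le> b * r" using s(3) r_pos by simp
    then have le: "1 - b * r \<le> 1 - s * r" by simp
    have "hausdorff_dist (?A s) (?A t) \<le> \<bar>s - t\<bar> * r * diameter K0 / (1 - s * r)"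
      using s t by (intro attractor_lipschitz) auto
    also have "\<dots> \<le> \<bar>s - t\<bar> * r * diameter K0 / (1 - b * r)"
      using le br r_pos diameter_K0 by (intro frac_le) auto
    also have "\<dots> \<le> \<bar>s - t\<bar> * C / (1 - b * r)"
      using br by (intro divide_right_mono) (auto simp: C_def algebra_simps)
    also have "\<dots> < e"
      using d br C by (simp add: field_simps)
    finally show ?thesis .
  qed
  show thesis
  proof (rule that[of "e * (1 - b * r) / C"])
    show "0 < e * (1 - b * r) / C" using assms br C by simp
    fix s t assume s: "0 < s" "s < 1 / r" and t: "0 < t" "t < 1 / r"
      and d: "\<bar>s - t\<bar> < e * (1 - b * r) / C"
    consider "s \<le> b" | "t \<le> b" | "b < s" "b < t" by linarith
    then show "hausdorff_dist (?A s) (?A t) < e"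
    proof cases
      case 1
      then show ?thesis using low s t d by blast
    next
      case 2
      then show ?thesis
        using low[OF t _ s] d hausdorff_dist_commute[of "?A s"] by (simp add: abs_minus_commute)
    next
      case 3
      have "hausdorff_dist (?A s) (?A t) \<le> hausdorff_dist (?A s) L + hausdorff_dist L (?A t)"
        using s t by (intro hausdorff_dist_triangle attractor_maps L) auto
      then show ?thesis
        using b(2)[OF 3(1) s(2)] b(2)[OF 3(2) t(2)] hausdorff_dist_commute[of L] by simp
    qed
  qed
qed

end

section \<open>Bounded families on the line\<close>

lemma real_nonsingular_affine:
  fixes f :: "real \<Rightarrow> real"
  assumes "nonsingular_affine f"
  obtains a b where "a \<noteq> 0" "f = (\<lambda>x. a * x + b)"
proof -
  obtain L b where L: "linear L" "bij L" "f = (\<lambda>x. L x + b)"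
    using assms by (auto simp: nonsingular_affine_def)
  have "L x = L 1 * x" for x
    using linear_scale[OF L(1), of x 1] by (simp add: mult.commute)
  moreover have "L 1 \<noteq> 0"
    using L(2) linear_0[OF L(1)] by (metis bij_pointE zero_neq_one)
  ultimately show thesis using that[of "L 1" b] L(3) by metis
qed

lemma scaling_ratio_real:
  fixes f :: "real \<Rightarrow> real"
  assumes "a \<noteq> 0" "\<And>x. f x = a * x + b"
  shows "scaling_ratio f = \<bar>a\<bar>"
  unfolding scaling_ratio_def
proof (rule the_equality)
  show "has_scaling_ratio f \<bar>a\<bar>"
    using assms by (simp add: has_scaling_ratio_def dist_real_def flip: abs_mult right_diff_distrib)
  fix s assume "has_scaling_ratio f s"
  then have "dist (f 1) (f 0) = s * dist (1::real) 0" by (auto simp: has_scaling_ratio_def)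
  then show "s = \<bar>a\<bar>" using assms by (simp add: dist_real_def)
qed

lemma onorm_mult_real: "onorm (\<lambda>x::real. a * x) = \<bar>a\<bar>"
proof -
  have "\<bar>a\<bar> \<le> onorm (\<lambda>x::real. a * x)"
    using onorm[OF bounded_linear_mult_right, of a 1] by simp
  moreover have "onorm (\<lambda>x::real. a * x) \<le> \<bar>a\<bar>"
    by (rule onorm_le) (simp add: abs_mult)
  ultimately show ?thesis by simp
qed

text \<open>Norms of linear maps of the line are multiplicative, so the largest norm of a word of length \<open>n\<close> is attained by
  repeating the dominant letter, and the \<open>n\<close>-th roots are constant for \<open>n > 0\<close>.\<close>

lemma joint_spectral_radius_real:
  fixes f :: "nat \<Rightarrow> real \<Rightarrow> real"
  assumes lin: "\<And>i. i \<in> {1..N} \<Longrightarrow> linear_part (f i) = (\<lambda>x. m i * x)"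
    and k: "k \<in> {1..N}" and le: "\<And>i. i \<in> {1..N} \<Longrightarrow> \<bar>m i\<bar> \<le> \<bar>m k\<bar>"
  shows "joint_spectral_radius N f = \<bar>m k\<bar>"
proof -
  have word: "word_map f w = (\<lambda>x. prod_list (map m w) * x)" if "set w \<subseteq> {1..N}" for w
    using that by (induction w) (auto simp: word_map_def lin fun_eq_iff)
  have abs_prod: "\<bar>prod_list (map m w)\<bar> \<le> \<bar>m k\<bar> ^ length w" if "set w \<subseteq> {1..N}" for w
    using that le by (induction w) (auto simp: abs_mult intro!: mult_mono)
  have "Max {onorm (word_map f w) |w. length w = n \<and> set w \<subseteq> {1..N}} = \<bar>m k\<bar> ^ n" for n
  proof (rule Max_eqI)
    have "finite {w. set w \<subseteq> {1..N} \<and> length w = n}" by (rule finite_lists_length_eq) simp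
    then have "finite {w. length w = n \<and> set w \<subseteq> {1..N}}" by (simp add: conj_commute)
    then show "finite {onorm (word_map f w) |w. length w = n \<and> set w \<subseteq> {1..N}}"
      by (simp add: setcompr_eq_image)
    fix y assume "y \<in> {onorm (word_map f w) |w. length w = n \<and> set w \<subseteq> {1..N}}"
    then show "y \<le> \<bar>m k\<bar> ^ n" using abs_prod by (auto simp: word onorm_mult_real)
  next
    let ?w = "replicate n k"
    have "set ?w \<subseteq> {1..N}" using k by auto
    moreover have "onorm (word_map f ?w) = \<bar>m k\<bar> ^ n"
      using calculation by (simp only: word onorm_mult_real) (simp add: power_abs)
    ultimately show "\<bar>m k\<bar> ^ n \<in> {onorm (word_map f w) |w. length w = n \<and> set w \<subseteq> {1..N}}"
      by (metis (mono_tags, lifting) length_replicate mem_Collect_eq)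
  qed
  then have "joint_spectral_radius N f
      = real_of_ereal (limsup (\<lambda>n. ereal (root n (\<bar>m k\<bar> ^ n))))"
    by (simp add: joint_spectral_radius_def)
  also have "limsup (\<lambda>n. ereal (root n (\<bar>m k\<bar> ^ n))) = ereal \<bar>m k\<bar>"
  proof (intro lim_imp_Limsup tendsto_eventually)
    show "\<forall>\<^sub>F n in sequentially. ereal (root n (\<bar>m k\<bar> ^ n)) = ereal \<bar>m k\<bar>"
      using eventually_gt_at_top[of 0]
      by eventually_elim (simp add: real_root_power_cancel)
  qed simp
  finally show ?thesis by simp
qed

text \<open>Linear maps fix \<open>0\<close>, so each \<open>t f\<^sub>i + q\<^sub>i\<close> fixes \<open>h 0\<close>. At \<open>t = 0\<close> this says that \<open>h 0\<close> is
  \<open>q\<^sub>i\<close>; any other parameter then gives the claim.\<close>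

lemma semi_linear_common_fixed_point:
  assumes "semi_linear N f q" "i \<in> {1..N}" "0 < t_crit N f"
  shows "f i (q i) = 0"
proof -
  obtain h where h: "\<And>t. t \<in> {0..<t_crit N f} \<Longrightarrow>
      \<exists>g. linear g \<and> conjugate_by h (fam_fun f q i t) g"
    using assms(1,2) unfolding semi_linear_def by blast
  have fixed: "fam_fun f q i t (h 0) = h 0" if t: "t \<in> {0..<t_crit N f}" for t
  proof -
    obtain g where g: "linear g" "bij h" "g = inv h \<circ> fam_fun f q i t \<circ> h"
      using h[OF t] by (auto simp: conjugate_by_def)
    have "h (g 0) = fam_fun f q i t (h 0)"
      using g(2,3) by (simp add: bij_is_surj surj_f_inv_f)
    then show ?thesis using linear_0[OF g(1)] by simp
  qed
  have "h 0 = q i" using fixed[of 0] assms(3) by (simp add: fam_fun_def)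
  then have "(t_crit N f / 2) *\<^sub>R f i (q i) + q i = q i"
    using fixed[of "t_crit N f / 2"] assms(3) by (simp add: fam_fun_def)
  then show ?thesis using assms(3) by simp
qed

theorem corollary8p2:
  fixes N :: nat and f :: "nat \<Rightarrow> real \<Rightarrow> real" and q :: "nat \<Rightarrow> real"
  assumes "bounded_family N f q"
  shows "uniform_family N f q \<and>
    (\<exists>Astar. compact Astar \<and> Astar \<noteq> {} \<and>
      ((\<lambda>t. hausdorff_dist (attractor (fam N f q t)) Astar) \<longlongrightarrow> 0) (at_left (t_crit N f)))"
proof -
  define m where "m i = f i 1 - f i 0" for i
  have aff: "affine_family N f q" and semi: "semi_linear N f q"
    using assms by (auto simp: bounded_family_def similarity_family_def)
  have m: "m i \<noteq> 0" "f i x = m i * x + f i 0" if "i \<in> {1..N}" for i x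
  proof -
    have "nonsingular_affine (f i)" using aff that by (auto simp: affine_family_def)
    then obtain a b where "a \<noteq> 0" "f i = (\<lambda>x. a * x + b)" by (rule real_nonsingular_affine)
    then show "m i \<noteq> 0" "f i x = m i * x + f i 0" by (auto simp: m_def)
  qed
  have ratio: "scaling_ratio (f i) = \<bar>m i\<bar>" if "i \<in> {1..N}" for i
    using m[OF that] by (rule scaling_ratio_real)
  define M where "M = Max ((\<lambda>j. scaling_ratio (f j)) ` {1..N})"
  define P where "P h \<longleftrightarrow> (\<exists>i\<in>{1..N}. h = fam_fun f q i \<and> scaling_ratio (f i) = M)" for h
  have "\<exists>!h. P h"
    using assms unfolding bounded_family_def M_def P_def by (elim conjE)
  then obtain h where h: "P h" "\<And>h'. P h' \<Longrightarrow> h' = h" by blast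
  obtain k where k: "k \<in> {1..N}" "scaling_ratio (f k) = M" and hk: "h = fam_fun f q k"
    using h(1) unfolding P_def by (elim bexE conjE)
  have unique: "fam_fun f q i = fam_fun f q k" if "i \<in> {1..N}" "scaling_ratio (f i) = M" for i
  proof -
    have "P (fam_fun f q i)" unfolding P_def by (intro bexI[of _ i] conjI refl that)
    then show ?thesis using h(2) hk by simp
  qed
  have le: "\<bar>m i\<bar> \<le> \<bar>m k\<bar>" if "i \<in> {1..N}" for i
  proof -
    have "scaling_ratio (f i) \<le> M" unfolding M_def using that by (intro Max_ge) auto
    then show ?thesis using k(2) ratio[OF that] ratio[OF k(1)] by simp
  qed
  have "linear_part (f i) = (\<lambda>x. m i * x)" if "i \<in> {1..N}" for i
    unfolding linear_part_def
  proof
    show "f i x - f i 0 = m i * x" for x using m(2)[OF that, of x] by linarith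
  qed
  then have crit: "t_crit N f = 1 / \<bar>m k\<bar>"
    using joint_spectral_radius_real[of N f m k] k(1) le by (simp add: t_crit_def)
  have pinned: "f i x = m i * (x - q i)" if i: "i \<in> {1..N}" for i x
  proof -
    have "f i (q i) = 0"
      using semi i crit m(1)[OF k(1)] by (intro semi_linear_common_fixed_point) auto
    then show ?thesis using m(2)[OF i, of x] m(2)[OF i, of "q i"] by (simp add: algebra_simps)
  qed
  have same: "m i = m k \<and> q i = q k" if i: "i \<in> {1..N}" "\<bar>m i\<bar> = \<bar>m k\<bar>" for i
  proof -
    have "scaling_ratio (f i) = M"
      using i(2) k(2) ratio[OF i(1)] ratio[OF k(1)] by simp
    then have "fam_fun f q i = fam_fun f q k" by (rule unique[OF i(1)])
    \<comment> \<open>The parameters \<open>0\<close> and \<open>1\<close> recover \<open>q i\<close> and \<open>f i\<close> from the two-variable function.\<close>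
    from fun_cong[OF fun_cong[OF this]]
    have eq: "t *\<^sub>R f i x + q i = t *\<^sub>R f k x + q k" for t x
      unfolding fam_fun_def by blast
    have "q i = q k" using eq[of 0] by simp
    moreover have "f i x = f k x" for x using eq[of 1 x] calculation by simp
    ultimately show ?thesis by (simp add: m_def)
  qed
  \<comment> \<open>Inserting \<open>0\<close> gives a valid \<open>c\<close> also when all members are copies of the dominant one.\<close>
  define c where "c = Max (insert 0 ((\<lambda>i. \<bar>m i\<bar> / \<bar>m k\<bar>) ` {i\<in>{1..N}. \<bar>m i\<bar> < \<bar>m k\<bar>}))"
  interpret dominated_family "{1..N}" m q k c
  proof
    show "0 \<le> c" unfolding c_def by (intro Max_ge) auto
    show "c < 1" unfolding c_def by (subst Max_less_iff) auto
    fix i assume i: "i \<in> {1..N}"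
    show "\<bar>m i\<bar> \<le> c * \<bar>m k\<bar> \<or> (m i = m k \<and> q i = q k)"
    proof (cases "\<bar>m i\<bar> < \<bar>m k\<bar>")
      case True
      then have "\<bar>m i\<bar> / \<bar>m k\<bar> \<le> c" unfolding c_def using i by (intro Max_ge) auto
      then show ?thesis using m(1)[OF k(1)] by (simp add: field_simps)
    next
      case False
      then show ?thesis using same le[OF i] i by force
    qed
  qed (use k m in auto)
  have maps: "fam N f q t = g t ` {1..N}" for t
    unfolding fam_def by (intro image_cong) (auto simp: fam_fun_def g_def pinned fun_eq_iff)
  have crit': "t_crit N f = 1 / r" using crit by (simp add: r_def)
  have "uniform_family N f q"
    unfolding uniform_family_def
  proof (intro conjI allI impI aff)
    fix e :: real assume "0 < e"
    then obtain d where "0 < d" and d: "\<And>s t. 0 < s \<Longrightarrow> s < 1 / r \<Longrightarrow> 0 < t \<Longrightarrow> t < 1 / r \<Longrightarrow>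
        \<bar>s - t\<bar> < d \<Longrightarrow> hausdorff_dist (attractor (g s ` {1..N})) (attractor (g t ` {1..N})) < e"
      by (rule attractor_uniformly_continuous) blast
    then show "\<exists>d>0. \<forall>s\<in>{0<..<t_crit N f}. \<forall>t\<in>{0<..<t_crit N f}. \<bar>s - t\<bar> < d \<longrightarrow>
        hausdorff_dist (attractor (fam N f q s)) (attractor (fam N f q t)) < e"
      unfolding maps crit' by (intro exI[of _ d]) auto
  qed
  moreover obtain L where L: "compact L" "L \<noteq> {}" "sweep (parts (1 / r) L) = L"
    by (rule limit_set_exists)
  ultimately show ?thesis
    using attractor_tendsto[OF L] unfolding maps crit' by blast
qed

end
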